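(* There is an algorithm solving \textsc{Wide Family Hitting} in time $2^{\mathcal{O}(k \log k)} N^{\mathcal{O}(1)}$.
   Context: For an integer $k$ and a universe $U$, a family $\mathcal{F}$ of subsets of $U$ is $k$-wide if $|A\cup B|>k$ for any two distinct $A,B\in\mathcal{F}$. In \textsc{Wide Family Hitting}, the input is an integer $k$, a universe $U$, and $m$ $k$-wide families $\mathcal{F}_1,\ldots,\mathcal{F}_m$ over $U$; the task is to decide whether there exist $S_1\in\mathcal{F}_1,\ldots,S_m\in\mathcal{F}_m$ with $|\bigcup_{i=1}^m S_i|\le k$. The input size is $N=\sum_{i=1}^m\sum_{A\in\mathcal{F}_i}|A|$.
   Formalization: In the time bound, N is replaced by max(1, N + number of families equal to {} or {{}}), since such families add nothing to N yet must be inspected (many copies of {{}} have N = 0); the bound is in N itself when m ≥ 1 and every family has a nonempty member. *)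

theory Defs
  imports Complex_Main
begin

text \<open>
  Wide Family Hitting. The families are indexed by a list. For negative \<open>k\<close> there is no
  solution, for the empty list of families the union is empty.
\<close>

definition wide :: "int \<Rightarrow> 'a set set \<Rightarrow> bool" where
  "wide k F \<longleftrightarrow> (\<forall>A\<in>F. \<forall>B\<in>F. A \<noteq> B \<longrightarrow> int (card (A \<union> B)) > k)"

definition wfh_instance :: "int \<Rightarrow> 'a set \<Rightarrow> 'a set set list \<Rightarrow> bool" where
  "wfh_instance k U Fs \<longleftrightarrow> finite U \<and> (\<forall>F\<in>set Fs. F \<subseteq> Pow U \<and> wide k F)"

definition wfh_solvable :: "int \<Rightarrow> 'a set set list \<Rightarrow> bool" where
  "wfh_solvable k Fs \<longleftrightarrow>
     (\<exists>S. (\<forall>i<length Fs. S i \<in> Fs ! i) \<and> int (card (\<Union>i<length Fs. S i)) \<le> k)"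

definition input_size :: "'a set set list \<Rightarrow> nat" where
  "input_size Fs = (\<Sum>i<length Fs. \<Sum>A\<in>Fs ! i. card A)"

text \<open>
  The families \<open>{}\<close> and \<open>{{}}\<close> contribute nothing to the input size, although an algorithm
  has to inspect each of them: a single empty family turns a positive instance into a negative
  one. No running time bound in terms of \<^const>\<open>input_size\<close> alone can hold when there are
  arbitrarily many of them, so the bound has to count them. The other families contribute at
  least 1 each.
\<close>

definition num_degenerate :: "'a set set list \<Rightarrow> nat" where
  "num_degenerate Fs = card {i. i < length Fs \<and> Fs ! i \<subseteq> {{}}}"


text \<open>
  Model of computation: first-order recursive programs on cells and integers, evaluated by
  value with unit cost for every evaluation step. Each step is a constant number of operations
  of a random access machine with uniform cost, addition and subtraction (a cell is a pair of
  machine words holding integers or pointers). There is no multiplication, and no unit-cost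
  comparison of compound values.

  A program is the list of the bodies of its functions; the first one is the main function.
  \<open>Arg i\<close> is the \<open>i\<close>-th argument of the function whose body is being evaluated.
\<close>

datatype val = Atom int | Cell val val

datatype exp =
    Arg nat
  | Const int
  | MkCell exp exp
  | Fst exp
  | Snd exp
  | IsCell exp
  | Plus exp exp
  | Minus exp exp
  | Less exp exp
  | Cond exp exp exp
  | Call nat "exp list"

type_synonym program = "exp list"

definition truth :: "bool \<Rightarrow> val" where
  "truth b = Atom (if b then 1 else 0)"

text \<open>
  \<open>eval P env e v t\<close>: the expression \<open>e\<close> evaluates to \<open>v\<close> in exactly \<open>t\<close> steps. Neither
  nonterminating nor ill-typed expressions (such as \<open>Fst\<close> of an atom) evaluate to anything.
\<close>

inductive eval :: "program \<Rightarrow> val list \<Rightarrow> exp \<Rightarrow> val \<Rightarrow> nat \<Rightarrow> bool"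
  and evals :: "program \<Rightarrow> val list \<Rightarrow> exp list \<Rightarrow> val list \<Rightarrow> nat \<Rightarrow> bool"
  for P :: program
where
  Arg: "i < length env \<Longrightarrow> eval P env (Arg i) (env ! i) 1"
| Const: "eval P env (Const c) (Atom c) 1"
| MkCell: "eval P env a x t \<Longrightarrow> eval P env b y u \<Longrightarrow>
    eval P env (MkCell a b) (Cell x y) (t + u + 1)"
| Fst: "eval P env a (Cell x y) t \<Longrightarrow> eval P env (Fst a) x (t + 1)"
| Snd: "eval P env a (Cell x y) t \<Longrightarrow> eval P env (Snd a) y (t + 1)"
| IsCell: "eval P env a x t \<Longrightarrow> eval P env (IsCell a) (truth (\<exists>y z. x = Cell y z)) (t + 1)"
| Plus: "eval P env a (Atom x) t \<Longrightarrow> eval P env b (Atom y) u \<Longrightarrow>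
    eval P env (Plus a b) (Atom (x + y)) (t + u + 1)"
| Minus: "eval P env a (Atom x) t \<Longrightarrow> eval P env b (Atom y) u \<Longrightarrow>
    eval P env (Minus a b) (Atom (x - y)) (t + u + 1)"
| Less: "eval P env a (Atom x) t \<Longrightarrow> eval P env b (Atom y) u \<Longrightarrow>
    eval P env (Less a b) (truth (x < y)) (t + u + 1)"
| Cond_True: "eval P env a (Atom x) t \<Longrightarrow> x \<noteq> 0 \<Longrightarrow> eval P env b v u \<Longrightarrow>
    eval P env (Cond a b c) v (t + u + 1)"
| Cond_False: "eval P env a (Atom x) t \<Longrightarrow> x = 0 \<Longrightarrow> eval P env c v u \<Longrightarrow>
    eval P env (Cond a b c) v (t + u + 1)"
| Call: "evals P env as xs t \<Longrightarrow> f < length P \<Longrightarrow> eval P xs (P ! f) v u \<Longrightarrow>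
    eval P env (Call f as) v (t + u + 1)"
| Nil: "evals P env [] [] 0"
| Cons: "eval P env a x t \<Longrightarrow> evals P env as xs u \<Longrightarrow> evals P env (a # as) (x # xs) (t + u)"

lemma eval_deterministic:
  "eval P env e v t \<Longrightarrow> eval P env e v' t' \<Longrightarrow> v' = v \<and> t' = t"
  "evals P env es vs t \<Longrightarrow> evals P env es vs' t' \<Longrightarrow> vs' = vs \<and> t' = t"
proof (induction arbitrary: v' t' and vs' t' rule: eval_evals.inducts)
  case Arg from Arg.prems show ?case by cases simp
next
  case Const from Const.prems show ?case by cases simp
next
  case MkCell from MkCell.prems show ?case by cases (auto dest!: MkCell.IH(2,4))
next
  case Fst from Fst.prems show ?case by cases (auto dest!: Fst.IH(2))
next
  case Snd from Snd.prems show ?case by cases (auto dest!: Snd.IH(2))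
next
  case IsCell from IsCell.prems show ?case by cases (auto dest!: IsCell.IH(2))
next
  case Plus from Plus.prems show ?case by cases (auto dest!: Plus.IH(2,4))
next
  case Minus from Minus.prems show ?case by cases (auto dest!: Minus.IH(2,4))
next
  case Less from Less.prems show ?case by cases (auto dest!: Less.IH(2,4))
next
  case Cond_True from Cond_True.prems show ?case by cases (use Cond_True.hyps in \<open>auto dest!: Cond_True.IH(2,4)\<close>)
next
  case Cond_False from Cond_False.prems show ?case by cases (use Cond_False.hyps in \<open>auto dest!: Cond_False.IH(2,4)\<close>)
next
  case Call from Call.prems show ?case by cases (auto dest!: Call.IH(2,5))
next
  case Nil from Nil.prems show ?case by cases simp
next
  case Cons from Cons.prems show ?case by cases (auto dest!: Cons.IH(2,4))
qed

definition computes :: "program \<Rightarrow> val \<Rightarrow> val \<Rightarrow> nat \<Rightarrow> bool" where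
  "computes P x v t \<longleftrightarrow> P \<noteq> [] \<and> eval P [x] (P ! 0) v t"


text \<open>
  The elements of the universe are named by natural numbers. The input consists of the integer,
  the universe, and the families. Sets, families and the sequence of families are lists, and the
  lists representing sets and families have no repetitions.
\<close>

fun encode_list :: "('a \<Rightarrow> val) \<Rightarrow> 'a list \<Rightarrow> val" where
  "encode_list f [] = Atom 0"
| "encode_list f (x # xs) = Cell (f x) (encode_list f xs)"

definition encode_set :: "nat list \<Rightarrow> val" where
  "encode_set = encode_list (\<lambda>x. Atom (int x))"

definition encode_input :: "int \<Rightarrow> nat list \<Rightarrow> nat list list list \<Rightarrow> val" where
  "encode_input k us fs =
     Cell (Atom k) (Cell (encode_set us) (encode_list (encode_list encode_set) fs))"

definition lists_set :: "'a list \<Rightarrow> 'a set \<Rightarrow> bool" where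
  "lists_set xs A \<longleftrightarrow> distinct xs \<and> set xs = A"

definition lists_family :: "'a list list \<Rightarrow> 'a set set \<Rightarrow> bool" where
  "lists_family xss F \<longleftrightarrow> (\<exists>As. lists_set As F \<and> list_all2 lists_set xss As)"

text \<open>\<open>x\<close> is one of the possible input representations of an instance.\<close>

definition represents :: "val \<Rightarrow> int \<Rightarrow> nat set \<Rightarrow> nat set set list \<Rightarrow> bool" where
  "represents x k U Fs \<longleftrightarrow>
     (\<exists>us fs. x = encode_input k us fs \<and> lists_set us U \<and> list_all2 lists_family fs Fs)"

definition solves_wfh :: "program \<Rightarrow> bool" where
  "solves_wfh P \<longleftrightarrow>
     (\<forall>k U Fs x. wfh_instance k U Fs \<longrightarrow> represents x k U Fs \<longrightarrow>
        (\<exists>t. computes P x (truth (wfh_solvable k Fs)) t))"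

text \<open>
  The running time is at most \<open>T k Fs\<close>. As the semantics is deterministic, it does not matter
  whether the number of steps is quantified universally or existentially here if \<open>P\<close> terminates.
\<close>

definition runs_in_time :: "program \<Rightarrow> (int \<Rightarrow> nat set set list \<Rightarrow> real) \<Rightarrow> bool" where
  "runs_in_time P T \<longleftrightarrow>
     (\<forall>k U Fs x. wfh_instance k U Fs \<longrightarrow> represents x k U Fs \<longrightarrow>
        (\<exists>v t. computes P x v t \<and> real t \<le> T k Fs))"

text \<open>\<open>k log k\<close>, read as \<open>0\<close> for \<open>k \<le> 0\<close>.\<close>

definition klogk :: "int \<Rightarrow> real" where
  "klogk k = (if k \<le> 0 then 0 else real_of_int k * log 2 (real_of_int k))"

end

theory Submission
  imports Defs
begin

text \<open>
  Guess the largest set \<open>B\<close> of a solution, then choose sets from the families one after the other,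
  keeping their union \<open>T\<close>, which initially is \<open>B\<close>. Only sets \<open>A\<close> with \<open>|A| \<le> |B|\<close> and
  \<open>|A \<union> T| \<le> k\<close> are candidates. As the families are wide, such a set is determined by \<open>A \<inter> B\<close>, so
  each family has at most \<open>2\<^sup>k\<close> candidates, and all candidates of a family but one at least halve
  the remaining budget \<open>r = k - |T|\<close>. With \<open>M = 2\<^sup>k\<close>, the number of leaves of the search tree obeys
  \<open>f (r + 1) \<le> f r + M f (r / 2)\<close>, which gives \<open>f k \<le> (1 + k M)\<^bsup>O(log k)\<^esup>\<close>, that is,
  \<open>2\<^bsup>O(k log k)\<^esup>\<close> for \<open>k \<ge> 2\<close>.
\<close>

section \<open>The search tree\<close>

fun reach :: "nat \<Rightarrow> nat \<Rightarrow> 'a set \<Rightarrow> 'a set set list \<Rightarrow> bool" where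
  "reach k b T [] \<longleftrightarrow> True"
| "reach k b T (F # Fs) \<longleftrightarrow> (\<exists>A\<in>F. card A \<le> b \<and> card (A \<union> T) \<le> k \<and> reach k b (A \<union> T) Fs)"

text \<open>The whole tree is counted, including what lies after the first success. The program
  stops there, so this is only an upper bound for its work, but one that is free of the order of the
  candidates.\<close>

fun nodes :: "nat \<Rightarrow> nat \<Rightarrow> 'a set \<Rightarrow> 'a set set list \<Rightarrow> nat" where
  "nodes k b T [] = 1"
| "nodes k b T (F # Fs) =
     1 + (\<Sum>A\<in>{A \<in> F. card A \<le> b \<and> card (A \<union> T) \<le> k}. nodes k b (A \<union> T) Fs)"

section \<open>The recurrence for the width of the search tree\<close>

fun growth :: "nat \<Rightarrow> nat \<Rightarrow> nat" where
  "growth M 0 = 1"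
| "growth M (Suc r) = growth M r + M * growth M (r div 2)"

lemma growth_mono: "r \<le> s \<Longrightarrow> growth M r \<le> growth M s"
  by (rule lift_Suc_mono_le) auto

lemma growth_ge_1: "1 \<le> growth M r"
  using growth_mono[of 0 r M] by simp

text \<open>Unrolling the recurrence \<open>r\<close> times leaves \<open>r\<close> summands, each
  at most \<open>M * growth M (R div 2)\<close> by monotonicity. \<open>R\<close> is separate from
  \<open>r\<close> so that it stays fixed in the induction.\<close>

lemma growth_le_half: "r \<le> R \<Longrightarrow> growth M r \<le> 1 + r * M * growth M (R div 2)"
proof (induction r)
  case (Suc r)
  have "M * growth M (r div 2) \<le> M * growth M (R div 2)"
    using Suc.prems by (intro mult_left_mono growth_mono div_le_mono) auto
  moreover have "growth M r \<le> 1 + r * M * growth M (R div 2)"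
    using Suc by simp
  ultimately show ?case unfolding growth.simps mult_Suc distrib_right by linarith
qed simp

text \<open>Each halving of the argument costs one factor \<open>1 + k * M\<close>, and
  \<open>j\<close> halvings take every \<open>r < 2 ^ j\<close> to 0, where \<open>growth\<close> is
  1.\<close>

lemma growth_le_power: "r < 2 ^ j \<Longrightarrow> r \<le> k \<Longrightarrow> growth M r \<le> (1 + k * M) ^ j"
proof (induction j arbitrary: r)
  case (Suc j)
  have "growth M r \<le> 1 + r * M * growth M (r div 2)"
    by (rule growth_le_half) simp
  also have "growth M (r div 2) \<le> (1 + k * M) ^ j"
    using Suc.prems by (intro Suc.IH) auto
  then have "1 + r * M * growth M (r div 2) \<le> (1 + k * M) ^ j + k * M * (1 + k * M) ^ j"
    using Suc.prems by (intro add_mono mult_mono) auto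
  finally show ?case by simp
qed simp

text \<open>
  If two small enough sets of a wide family have the same trace on \<open>B\<close> and each of them has a
  small union with \<open>B\<close>, then they have a small union with each other.
\<close>

lemma card_candidates_le:
  assumes "finite B" and fin: "\<And>A. A \<in> C \<Longrightarrow> finite A"
    and C: "\<And>A. A \<in> C \<Longrightarrow> card A \<le> card B \<and> card (A \<union> B) \<le> k"
    and wide: "wide (int k) C"
  shows "card C \<le> 2 ^ card B"
proof -
  have "inj_on (\<lambda>A. A \<inter> B) C"
  proof (rule inj_onI, rule ccontr)
    fix A A' assume A: "A \<in> C" "A' \<in> C" "A \<inter> B = A' \<inter> B" "A \<noteq> A'"
    have "int (card (A \<union> A')) > int k"
      using wide A unfolding wide_def by blast
    moreover have "card (A \<union> A') + card (A \<inter> A') = card A + card A'"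
      using A fin card_Un_Int[of A A'] by simp
    moreover have "card (A \<inter> B) \<le> card (A \<inter> A')"
      using A fin by (intro card_mono) auto
    moreover have "card (A \<union> B) + card (A \<inter> B) = card A + card B"
      using A fin \<open>finite B\<close> card_Un_Int[of A B] by simp
    \<comment> \<open>Together: |A \<union> A'| \<le> |A| + |A'| - |A \<inter> B| = |A'| + |A
      \<union> B| - |B| \<le> |A \<union> B| \<le> k.\<close>
    ultimately show False using C[of A] C[of A'] A(1,2) by linarith
  qed
  then have "card C = card ((\<lambda>A. A \<inter> B) ` C)" by (simp add: card_image)
  also have "\<dots> \<le> card (Pow B)" using \<open>finite B\<close> by (intro card_mono) auto
  finally show ?thesis using \<open>finite B\<close> by (simp add: card_Pow)
qed

text \<open>
  With \<open>r = k - |T|\<close>, any two candidates \<open>A\<close> and \<open>A'\<close> satisfy \<open>|A - T| + |A' - T| > r\<close>. Hence all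
  candidates but one at least halve \<open>r\<close>, and the last one decreases it unless it is the only one.
\<close>

lemma nodes_le:
  assumes "finite T" "B \<subseteq> T" "card T \<le> k"
    and "\<And>F. F \<in> set Fs \<Longrightarrow> finite F \<and> (\<forall>A\<in>F. finite A) \<and> wide (int k) F"
  shows "nodes k (card B) T Fs \<le> (length Fs + 1) * growth (2 ^ card B) (k - card T)"
  using assms
proof (induction Fs arbitrary: T)
  case Nil
  then show ?case using growth_ge_1 by simp
next
  case (Cons F Fs)
  define C where "C = {A \<in> F. card A \<le> card B \<and> card (A \<union> T) \<le> k}"
  define r where "r = k - card T"
  define g where "g = growth (2 ^ card B)"
  define l where "l = length Fs + 1"
  have finB: "finite B" using Cons.prems finite_subset by blast
  have F: "finite F" "wide (int k) F" and finA: "\<And>A. A \<in> F \<Longrightarrow> finite A"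
    using Cons.prems(4)[of F] by auto
  have C: "finite C" "wide (int k) C"
    using F by (auto simp: C_def wide_def)
  have finC: "finite A" if "A \<in> C" for A using that finA by (simp add: C_def)
  have AT: "card (A \<union> T) = card (A - T) + card T" if "A \<in> C" for A
    using Cons.prems(1) finC[OF that] card_Un_disjoint[of "A - T" T] by auto
  have le_r: "card (A - T) \<le> r" if "A \<in> C" for A
    using AT[OF that] that unfolding C_def r_def mem_Collect_eq by linarith
  have two: "r < card (A - T) + card (A' - T)" if "A \<in> C" "A' \<in> C" "A \<noteq> A'" for A A'
  proof -
    have "k < card (A \<union> A')" using C that unfolding wide_def by auto
    also have "card (A \<union> A') \<le> card (T \<union> (A - T) \<union> (A' - T))"
      using that Cons.prems(1) finC by (intro card_mono) auto
    also have "card (T \<union> (A - T) \<union> (A' - T)) \<le> card T + card (A - T) + card (A' - T)"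
      using card_Un_le[of "T \<union> (A - T)" "A' - T"] card_Un_le[of T "A - T"] by linarith
    finally show ?thesis using Cons.prems(3) unfolding r_def by linarith
  qed
  have "card C \<le> 2 ^ card B"
  proof (rule card_candidates_le[OF finB finC])
    fix A assume A: "A \<in> C"
    have "card (A \<union> B) \<le> card (A \<union> T)"
      using Cons.prems(1,2) finC[OF A] by (intro card_mono) auto
    then show "card A \<le> card B \<and> card (A \<union> B) \<le> k" using A by (simp add: C_def)
  qed (use C in auto)
  \<comment> \<open>Here \<open>s\<close> is any bound on the budget left after choosing
    \<open>A\<close>. It becomes \<open>r\<close> for a sole candidate, otherwise
    \<open>r - 1\<close> for the exceptional one and \<open>(r - 1) div 2\<close> for the
    rest.\<close>
  have sub: "nodes k (card B) (A \<union> T) Fs \<le> l * g s"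
    if "A \<in> C" "r \<le> card (A - T) + s" for A s
  proof -
    have "nodes k (card B) (A \<union> T) Fs \<le> l * g (k - card (A \<union> T))"
      unfolding l_def g_def
    proof (rule Cons.IH)
      show "finite (A \<union> T)" "B \<subseteq> A \<union> T"
        using Cons.prems(1,2) finC[OF that(1)] by auto
      show "card (A \<union> T) \<le> k" using that(1) by (simp add: C_def)
      show "finite F' \<and> (\<forall>A\<in>F'. finite A) \<and> wide (int k) F'" if "F' \<in> set Fs" for F'
        using Cons.prems(4)[of F'] that by simp
    qed
    also have "\<dots> \<le> l * g s"
      unfolding g_def using that AT[OF that(1)]
      by (intro mult_left_mono growth_mono) (auto simp: r_def)
    finally show ?thesis .
  qed
  have sum: "(\<Sum>A\<in>C. nodes k (card B) (A \<union> T) Fs) \<le> l * g r"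
  proof (cases "C = {}")
    case False
    \<comment> \<open>The candidate adding the fewest new elements is the only one that may fail to
      halve the budget.\<close>
    then obtain A0 where A0: "A0 \<in> C" "\<And>A. A \<in> C \<Longrightarrow> card (A0 - T) \<le> card (A - T)"
      using C(1) arg_min_if_finite[of C "\<lambda>A. card (A - T)"] by (metis not_le)
    show ?thesis
    proof (cases "C = {A0}")
      case True
      then show ?thesis using sub[OF A0(1), of r] by simp
    next
      case False
      then obtain A1 where A1: "A1 \<in> C" "A1 \<noteq> A0" using A0 by blast
      \<comment> \<open>Each of the two candidates adds at most \<open>r\<close> elements, but
        together they add more than \<open>r\<close>, so neither adds none.\<close>
      then have pos: "card (A0 - T) > 0" "r > 0"
        using two[of A0 A1] le_r[of A0] le_r[of A1] A0(1) by auto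
      have "nodes k (card B) (A \<union> T) Fs \<le> l * g ((r - 1) div 2)" if "A \<in> C - {A0}" for A
      proof (rule sub)
        have "r < card (A - T) + card (A0 - T)" "card (A0 - T) \<le> card (A - T)"
          using that two[of A A0] A0 by auto
        \<comment> \<open>Since 2 |A - T| \<ge> r + 1, the budget left is at most
          \<open>(r - 1) div 2\<close>, which is the argument in the recurrence of
          \<open>growth\<close> at \<open>Suc (r - 1)\<close>.\<close>
        then show "r \<le> card (A - T) + (r - 1) div 2" by linarith
      qed (use that in simp)
      then have "(\<Sum>A\<in>C - {A0}. nodes k (card B) (A \<union> T) Fs)
          \<le> card (C - {A0}) * (l * g ((r - 1) div 2))"
        using sum_bounded_above[of "C - {A0}"] by (metis of_nat_id)
      also have "\<dots> \<le> 2 ^ card B * (l * g ((r - 1) div 2))"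
        using \<open>card C \<le> 2 ^ card B\<close> card_Diff1_le[of C A0] by (intro mult_right_mono) auto
      finally have rest: "(\<Sum>A\<in>C - {A0}. nodes k (card B) (A \<union> T) Fs)
          \<le> 2 ^ card B * (l * g ((r - 1) div 2))" .
      have "nodes k (card B) (A0 \<union> T) Fs \<le> l * g (r - 1)"
        using pos by (intro sub A0) linarith
      with rest have "(\<Sum>A\<in>C. nodes k (card B) (A \<union> T) Fs)
          \<le> l * g (r - 1) + 2 ^ card B * (l * g ((r - 1) div 2))"
        using sum.remove[OF C(1) A0(1), of "\<lambda>A. nodes k (card B) (A \<union> T) Fs"] by linarith
      also have "\<dots> = l * g r"
        using pos(2) by (cases r) (simp_all add: g_def algebra_simps)
      finally show ?thesis .
    qed
  qed simp
  have "nodes k (card B) T (F # Fs) \<le> 1 + l * g r"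
    using sum by (simp add: C_def)
  \<comment> \<open>The node itself is paid for by \<open>1 \<le> g r\<close>; hence one copy of
    \<open>growth\<close> per level.\<close>
  also have "\<dots> \<le> (length (F # Fs) + 1) * g r"
    using growth_ge_1[of "2 ^ card B" r] by (simp add: l_def g_def)
  finally show ?case by (simp add: g_def r_def)
qed

section \<open>Correctness of the search\<close>

lemma list_all2_memD: "list_all2 (\<in>) As Fs \<Longrightarrow> A \<in> set As \<Longrightarrow> \<exists>F\<in>set Fs. A \<in> F"
  by (induction rule: list_all2_induct) auto

text \<open>Testing every intermediate union is equivalent to testing the last one, because unions
  only grow. Finiteness makes \<open>card\<close> monotone here.\<close>

lemma reach_iff:
  assumes "finite T" "\<And>F A. F \<in> set Fs \<Longrightarrow> A \<in> F \<Longrightarrow> finite A" "card T \<le> k"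
  shows "reach k b T Fs \<longleftrightarrow>
    (\<exists>As. list_all2 (\<in>) As Fs \<and> (\<forall>A\<in>set As. card A \<le> b) \<and> card (\<Union>(set As) \<union> T) \<le> k)"
  using assms
proof (induction Fs arbitrary: T)
  case (Cons F Fs)
  have fin: "finite A" if "A \<in> F" for A using Cons.prems(2)[of F A] that by simp
  have IH: "reach k b (A \<union> T) Fs \<longleftrightarrow> (\<exists>As. list_all2 (\<in>) As Fs \<and> (\<forall>A\<in>set As. card A \<le> b) \<and>
      card (\<Union>(set As) \<union> (A \<union> T)) \<le> k)" if "A \<in> F" "card (A \<union> T) \<le> k" for A
    using Cons.prems that fin by (intro Cons.IH) auto
  have le: "card (A \<union> T) \<le> k"
    if "A \<in> F" "list_all2 (\<in>) As Fs" "card (\<Union>(set As) \<union> (A \<union> T)) \<le> k" for A As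
  proof -
    have "finite A'" if "A' \<in> set As" for A'
      using \<open>list_all2 (\<in>) As Fs\<close> that Cons.prems(2)
      by (auto dest: list_all2_memD)
    then have "card (A \<union> T) \<le> card (\<Union>(set As) \<union> (A \<union> T))"
      using that fin Cons.prems(1) by (intro card_mono) auto
    then show ?thesis using that by simp
  qed
  show ?case
  proof
    assume "reach k b T (F # Fs)"
    then obtain A As where A: "A \<in> F" "card A \<le> b" "list_all2 (\<in>) As Fs"
        "\<forall>A\<in>set As. card A \<le> b" "card (\<Union>(set As) \<union> (A \<union> T)) \<le> k"
      using IH by auto
    then show "\<exists>As. list_all2 (\<in>) As (F # Fs) \<and> (\<forall>A\<in>set As. card A \<le> b) \<and>
        card (\<Union>(set As) \<union> T) \<le> k"
      by (intro exI[of _ "A # As"]) (auto simp: Un_ac)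
  next
    assume "\<exists>As. list_all2 (\<in>) As (F # Fs) \<and> (\<forall>A\<in>set As. card A \<le> b) \<and>
        card (\<Union>(set As) \<union> T) \<le> k"
    then obtain A As where A: "A \<in> F" "card A \<le> b" "list_all2 (\<in>) As Fs"
        "\<forall>A\<in>set As. card A \<le> b" "card (\<Union>(set As) \<union> (A \<union> T)) \<le> k"
      by (auto simp: list_all2_Cons2 Un_ac)
    then have "card (A \<union> T) \<le> k" using le by blast
    moreover from this have "reach k b (A \<union> T) Fs" using A IH by blast
    ultimately show "reach k b T (F # Fs)" using A by auto
  qed
qed simp

text \<open>A list of chosen sets, unlike a function on indices, fits inductions along
  \<open>Fs\<close>.\<close>

lemma wfh_solvable_iff_list:
  "wfh_solvable k Fs \<longleftrightarrow> (\<exists>As. list_all2 (\<in>) As Fs \<and> int (card (\<Union>(set As))) \<le> k)"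
proof
  assume "wfh_solvable k Fs"
  then obtain S where S: "\<forall>i<length Fs. S i \<in> Fs ! i" "int (card (\<Union>i<length Fs. S i)) \<le> k"
    unfolding wfh_solvable_def by blast
  then show "\<exists>As. list_all2 (\<in>) As Fs \<and> int (card (\<Union>(set As))) \<le> k"
    by (intro exI[of _ "map S [0..<length Fs]"])
      (auto simp: list_all2_conv_all_nth lessThan_atLeast0)
next
  assume "\<exists>As. list_all2 (\<in>) As Fs \<and> int (card (\<Union>(set As))) \<le> k"
  then obtain As where As: "list_all2 (\<in>) As Fs" "int (card (\<Union>(set As))) \<le> k" by blast
  have "(\<Union>i<length Fs. As ! i) = \<Union>(set As)"
    using list_all2_lengthD[OF As(1)] nth_image[of "length As" As] by (simp add: lessThan_atLeast0)
  then show "wfh_solvable k Fs"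
    unfolding wfh_solvable_def using As
    by (intro exI[of _ "\<lambda>i. As ! i"]) (auto simp: list_all2_conv_all_nth)
qed

text \<open>A largest set \<open>B\<close> of a solution lies in its union, so starting from
  \<open>B\<close> costs nothing. Conversely, the sets found need not include \<open>B\<close>, but
  dropping it only shrinks the union. Without families there is no \<open>B\<close> to
  guess.\<close>

lemma wfh_solvable_iff_reach:
  assumes fin: "\<And>F A. F \<in> set Fs \<Longrightarrow> A \<in> F \<Longrightarrow> finite A"
  shows "wfh_solvable (int k) Fs \<longleftrightarrow>
    Fs = [] \<or> (\<exists>F\<in>set Fs. \<exists>B\<in>F. card B \<le> k \<and> reach k (card B) B Fs)"
proof
  assume "wfh_solvable (int k) Fs"
  then obtain As where As: "list_all2 (\<in>) As Fs" "card (\<Union>(set As)) \<le> k"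
    unfolding wfh_solvable_iff_list by auto
  have finAs: "finite A" if "A \<in> set As" for A
    using list_all2_memD[OF As(1) that] fin by blast
  show "Fs = [] \<or> (\<exists>F\<in>set Fs. \<exists>B\<in>F. card B \<le> k \<and> reach k (card B) B Fs)"
  proof (cases "Fs = []")
    case False
    then have "set As \<noteq> {}" using As(1) by auto
    then obtain B where B: "B \<in> set As" "\<forall>A\<in>set As. card A \<le> card B"
      using obtains_MAX[of "set As" card]
      by (metis (no_types, lifting) List.finite_set Max_ge finite_imageI imageI)
    have "card B \<le> card (\<Union>(set As))"
      using B finAs by (intro card_mono) auto
    moreover have "\<Union>(set As) \<union> B = \<Union>(set As)" using B by auto
    ultimately have "card B \<le> k" "reach k (card B) B Fs"
      using As B finAs fin by (auto simp: reach_iff)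
    moreover obtain F where "F \<in> set Fs" "B \<in> F"
      using list_all2_memD[OF As(1) B(1)] by blast
    ultimately show ?thesis by blast
  qed simp
next
  assume R: "Fs = [] \<or> (\<exists>F\<in>set Fs. \<exists>B\<in>F. card B \<le> k \<and> reach k (card B) B Fs)"
  show "wfh_solvable (int k) Fs"
  proof (cases "Fs = []")
    case True
    then show ?thesis by (simp add: wfh_solvable_def)
  next
    case False
    then obtain F B where B: "F \<in> set Fs" "B \<in> F" "card B \<le> k" "reach k (card B) B Fs"
      using R by blast
    then have finB: "finite B" using fin by blast
    then obtain As where As: "list_all2 (\<in>) As Fs" "card (\<Union>(set As) \<union> B) \<le> k"
      using B fin reach_iff[of B Fs k "card B"] by auto
    have "finite A" if "A \<in> set As" for A
      using list_all2_memD[OF As(1) that] fin by blast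
    then have "card (\<Union>(set As)) \<le> card (\<Union>(set As) \<union> B)"
      using finB by (intro card_mono) auto
    then show ?thesis using As unfolding wfh_solvable_iff_list by auto
  qed
qed

section \<open>The program\<close>

definition "main_fn = (0 :: nat)"
definition "member_fn = (1 :: nat)"
definition "union_fn = (2 :: nat)"
definition "length_fn = (3 :: nat)"
definition "search_fn = (4 :: nat)"
definition "branch_fn = (5 :: nat)"
definition "start_family_fn = (6 :: nat)"
definition "start_fn = (7 :: nat)"

lemmas fn_defs = main_fn_def member_fn_def union_fn_def length_fn_def search_fn_def branch_fn_def
  start_family_fn_def start_fn_def

text \<open>
  The arguments of search are \<open>k\<close>, \<open>b\<close>, the current union \<open>T\<close> and the remaining families; branch
  also gets, before the latter, the remaining members of the family it chooses from. The start
  functions choose the largest set of a solution; their last argument is the list of all families.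
\<close>

definition main_body :: exp where
  "main_body =
    Cond (Less (Fst (Arg 0)) (Const 0)) (Const 0)
      (Cond (IsCell (Snd (Snd (Arg 0))))
        (Call start_fn [Fst (Arg 0), Snd (Snd (Arg 0)), Snd (Snd (Arg 0))])
        (Const 1))"

text \<open>Equality of atoms is expressed as the failure of both strict comparisons.\<close>

definition member_body :: exp where
  "member_body =
    Cond (IsCell (Arg 1))
      (Cond (Less (Arg 0) (Fst (Arg 1))) (Call member_fn [Arg 0, Snd (Arg 1)])
        (Cond (Less (Fst (Arg 1)) (Arg 0)) (Call member_fn [Arg 0, Snd (Arg 1)])
          (Const 1)))
      (Const 0)"

definition union_body :: exp where
  "union_body =
    Cond (IsCell (Arg 0))
      (Cond (Call member_fn [Fst (Arg 0), Arg 1])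
        (Call union_fn [Snd (Arg 0), Arg 1])
        (MkCell (Fst (Arg 0)) (Call union_fn [Snd (Arg 0), Arg 1])))
      (Arg 1)"

definition length_body :: exp where
  "length_body =
    Cond (IsCell (Arg 0)) (Plus (Call length_fn [Snd (Arg 0)]) (Const 1)) (Const 0)"

definition search_body :: exp where
  "search_body =
    Cond (IsCell (Arg 3))
      (Call branch_fn [Arg 0, Arg 1, Arg 2, Fst (Arg 3), Snd (Arg 3)])
      (Const 1)"

text \<open>As the language has no local bindings, the union with an accepted candidate is computed
  twice.\<close>

definition branch_body :: exp where
  "branch_body =
    Cond (IsCell (Arg 3))
      (Cond (Less (Arg 1) (Call length_fn [Fst (Arg 3)]))
        (Call branch_fn [Arg 0, Arg 1, Arg 2, Snd (Arg 3), Arg 4])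
        (Cond (Less (Arg 0) (Call length_fn [Call union_fn [Fst (Arg 3), Arg 2]]))
          (Call branch_fn [Arg 0, Arg 1, Arg 2, Snd (Arg 3), Arg 4])
          (Cond (Call search_fn [Arg 0, Arg 1, Call union_fn [Fst (Arg 3), Arg 2], Arg 4])
            (Const 1)
            (Call branch_fn [Arg 0, Arg 1, Arg 2, Snd (Arg 3), Arg 4]))))
      (Const 0)"

definition start_family_body :: exp where
  "start_family_body =
    Cond (IsCell (Arg 1))
      (Cond (Less (Arg 0) (Call length_fn [Fst (Arg 1)]))
        (Call start_family_fn [Arg 0, Snd (Arg 1), Arg 2])
        (Cond (Call search_fn [Arg 0, Call length_fn [Fst (Arg 1)], Fst (Arg 1), Arg 2])
          (Const 1)
          (Call start_family_fn [Arg 0, Snd (Arg 1), Arg 2])))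
      (Const 0)"

definition start_body :: exp where
  "start_body =
    Cond (IsCell (Arg 1))
      (Cond (Call start_family_fn [Arg 0, Fst (Arg 1), Arg 2])
        (Const 1)
        (Call start_fn [Arg 0, Snd (Arg 1), Arg 2]))
      (Const 0)"

definition wfh_program :: program where
  "wfh_program = [main_body, member_body, union_body, length_body, search_body, branch_body,
    start_family_body, start_body]"

section \<open>Symbolic execution\<close>

lemma wfh_program_nth:
  "wfh_program ! main_fn = main_body"
  "wfh_program ! member_fn = member_body"
  "wfh_program ! union_fn = union_body"
  "wfh_program ! length_fn = length_body"
  "wfh_program ! search_fn = search_body"
  "wfh_program ! branch_fn = branch_body"
  "wfh_program ! start_family_fn = start_family_body"
  "wfh_program ! start_fn = start_body"
  by (simp_all add: wfh_program_def fn_defs)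

lemma fn_less: "member_fn < length wfh_program" "union_fn < length wfh_program"
  "length_fn < length wfh_program" "search_fn < length wfh_program"
  "branch_fn < length wfh_program" "start_family_fn < length wfh_program"
  "start_fn < length wfh_program"
  by (simp_all add: wfh_program_def fn_defs)

text \<open>An opaque form of evaluating a function body: simplification with
  \<open>exec_simps\<close> executes one body and stops at the calls in it.\<close>

definition call :: "nat \<Rightarrow> val list \<Rightarrow> val \<Rightarrow> nat \<Rightarrow> bool" where
  "call f xs v t \<longleftrightarrow> eval wfh_program xs (wfh_program ! f) v t"

definition runs :: "nat \<Rightarrow> val list \<Rightarrow> val \<Rightarrow> nat \<Rightarrow> bool" where
  "runs f xs v n \<longleftrightarrow> (\<exists>t\<le>n. call f xs v t)"

text \<open>By determinism, a single run yields an equivalence that rewrites every occurrence of the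
  call, so known calls can be substituted into a body by the simplifier.\<close>

lemma runsE:
  assumes "runs f xs v n"
  obtains t where "t \<le> n" "\<forall>v' t'. call f xs v' t' \<longleftrightarrow> v' = v \<and> t' = t"
  using assms eval_deterministic(1) unfolding runs_def call_def by metis

inductive_simps eval_simps:
  "eval P env (Arg i) v t"
  "eval P env (Const c) v t"
  "eval P env (MkCell a b) v t"
  "eval P env (Fst a) v t"
  "eval P env (Snd a) v t"
  "eval P env (IsCell a) v t"
  "eval P env (Plus a b) v t"
  "eval P env (Less a b) v t"
  "eval P env (Cond a b c) v t"
  "evals P env [] vs t"
  "evals P env (a # as) vs t"

inductive_simps eval_Call: "eval P env (Call f as) v t"

lemma eval_Call_iff:
  assumes "f < length wfh_program"
  shows "eval wfh_program env (Call f as) v t \<longleftrightarrow>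
    (\<exists>xs t1 t2. evals wfh_program env as xs t1 \<and> call f xs v t2 \<and> t = t1 + t2 + 1)"
  using assms by (auto simp: eval_Call call_def)

lemmas exec_simps = eval_simps eval_Call_iff fn_less truth_def

lemma encode_set_simps [simp]:
  "encode_set [] = Atom 0"
  "encode_set (x # xs) = Cell (Atom (int x)) (encode_set xs)"
  by (simp_all add: encode_set_def)

section \<open>Running times of the list functions\<close>

lemma member_runs:
  "runs member_fn [Atom (int x), encode_set xs] (truth (x \<in> set xs)) (20 * (length xs + 1))"
proof (induction xs)
  case Nil
  show ?case
    unfolding runs_def call_def[of member_fn] wfh_program_nth member_body_def
    by (simp add: exec_simps)
next
  case (Cons y xs)
  then obtain t where t: "t \<le> 20 * (length xs + 1)"
    "\<forall>v' t'. call member_fn [Atom (int x), encode_set xs] v' t' \<longleftrightarrow> v' = truth (x \<in> set xs) \<and> t' = t"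
    by (rule runsE)
  show ?case
    unfolding runs_def call_def[of member_fn] wfh_program_nth member_body_def
    using t(1) by (auto simp: t(2) exec_simps)
qed

lemma length_runs: "runs length_fn [encode_set xs] (Atom (int (length xs))) (10 * (length xs + 1))"
proof (induction xs)
  case Nil
  show ?case
    unfolding runs_def call_def[of length_fn] wfh_program_nth length_body_def
    by (simp add: exec_simps)
next
  case (Cons y xs)
  then obtain t where t: "t \<le> 10 * (length xs + 1)"
    "\<forall>v' t'. call length_fn [encode_set xs] v' t' \<longleftrightarrow> v' = Atom (int (length xs)) \<and> t' = t"
    by (rule runsE)
  show ?case
    unfolding runs_def call_def[of length_fn] wfh_program_nth length_body_def
    using t(1) by (auto simp: t(2) exec_simps)
qed

text \<open>Reproduces the exact list built by \<open>union_body\<close>, order included. It keeps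
  lists free of repetitions, so that the program can measure cardinalities by lengths.\<close>

definition list_union :: "'a list \<Rightarrow> 'a list \<Rightarrow> 'a list" where
  "list_union xs ys = filter (\<lambda>x. x \<notin> set ys) xs @ ys"

lemma set_list_union [simp]: "set (list_union xs ys) = set xs \<union> set ys"
  by (auto simp: list_union_def)

lemma distinct_list_union: "distinct xs \<Longrightarrow> distinct ys \<Longrightarrow> distinct (list_union xs ys)"
  by (auto simp: list_union_def)

lemma length_list_union_le: "length (list_union xs ys) \<le> length xs + length ys"
  by (simp add: list_union_def)

text \<open>Each entry of \<open>xs\<close> costs a membership test of at most
  \<open>20 * (length ys + 1)\<close> steps; the other half of the constant 40 pays for the rest of
  the round.\<close>

lemma union_runs:
  "runs union_fn [encode_set xs, encode_set ys] (encode_set (list_union xs ys))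
     (40 * (length xs + 1) * (length ys + 1))"
proof (induction xs)
  case Nil
  show ?case
    unfolding runs_def call_def[of union_fn] wfh_program_nth union_body_def
    by (simp add: exec_simps
        list_union_def)
next
  case (Cons x xs)
  then obtain t where t: "t \<le> 40 * (length xs + 1) * (length ys + 1)"
    "\<forall>v' t'. call union_fn [encode_set xs, encode_set ys] v' t' \<longleftrightarrow>
      v' = encode_set (list_union xs ys) \<and> t' = t"
    by (rule runsE)
  obtain u where u: "u \<le> 20 * (length ys + 1)"
    "\<forall>v' t'. call member_fn [Atom (int x), encode_set ys] v' t' \<longleftrightarrow>
      v' = truth (x \<in> set ys) \<and> t' = u"
    using member_runs by (rule runsE)
  show ?case
    unfolding runs_def call_def[of union_fn] wfh_program_nth union_body_def
    using t(1) u(1) by (auto simp: t(2) u(2) exec_simps list_union_def algebra_simps)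
qed

section \<open>Running times of the search functions\<close>

lemma lists_family_Nil [simp]: "lists_family [] F \<longleftrightarrow> F = {}"
  by (auto simp: lists_family_def lists_set_def)

text \<open>The freshness of \<open>set xs\<close> lets sums over the family split off its first
  member.\<close>

lemma lists_family_Cons:
  "lists_family (xs # xss) F \<longleftrightarrow>
    (\<exists>F'. distinct xs \<and> F = insert (set xs) F' \<and> set xs \<notin> F' \<and> lists_family xss F')"
proof
  assume "lists_family (xs # xss) F"
  then obtain As where "distinct (set xs # As)" "set (set xs # As) = F" "distinct xs"
      "list_all2 lists_set xss As"
    by (auto simp: lists_family_def lists_set_def list_all2_Cons1)
  then show "\<exists>F'. distinct xs \<and> F = insert (set xs) F' \<and> set xs \<notin> F' \<and> lists_family xss F'"
    by (intro exI[of _ "set As"]) (auto simp: lists_family_def lists_set_def)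
next
  assume "\<exists>F'. distinct xs \<and> F = insert (set xs) F' \<and> set xs \<notin> F' \<and> lists_family xss F'"
  then obtain As where "distinct xs" "F = insert (set xs) (set As)" "set xs \<notin> set As"
      "distinct As" "list_all2 lists_set xss As"
    by (auto simp: lists_family_def lists_set_def)
  then show "lists_family (xs # xss) F"
    unfolding lists_family_def by (intro exI[of _ "set xs # As"]) (simp add: lists_set_def)
qed

lemma lists_family_finite: "lists_family xss F \<Longrightarrow> finite F"
  by (auto simp: lists_family_def lists_set_def)

lemma lists_family_length:
  "lists_family xss F \<Longrightarrow> length xss = card F"
  unfolding lists_family_def lists_set_def
  by (metis distinct_card list_all2_lengthD)

text \<open>\<open>C\<close> is the cost per node of the tree, and \<open>fv\<close> is the value
  that encodes \<open>Fs\<close>. This is the interface between the mutually recursive search and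
  branch functions.\<close>

definition search_correct where
  "search_correct k b C Fs fv \<longleftrightarrow> (\<forall>ts. distinct ts \<longrightarrow> length ts \<le> k \<longrightarrow>
     runs search_fn [Atom (int k), Atom (int b), encode_set ts, fv]
       (truth (reach k b (set ts) Fs)) (C * nodes k b (set ts) Fs))"

text \<open>The inner of two nested inductions: it runs through one family and takes the search of
  the later families for granted. Each member costs \<open>D\<close>, besides the subtree below it
  if it is a candidate.\<close>

lemma branch_runs:
  assumes "lists_family xss F" "\<And>A. A \<in> F \<Longrightarrow> card A \<le> n" "distinct ts" "length ts \<le> k"
    and D: "200 * ((n + 1) * (k + 1)) \<le> D" and "search_correct k b C Fs fv"
  shows "runs branch_fn
    [Atom (int k), Atom (int b), encode_set ts, encode_list encode_set xss, fv]
    (truth (\<exists>A\<in>F. card A \<le> b \<and> card (A \<union> set ts) \<le> k \<and> reach k b (A \<union> set ts) Fs))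
    (10 + length xss * D
      + C * (\<Sum>A\<in>{A \<in> F. card A \<le> b \<and> card (A \<union> set ts) \<le> k}. nodes k b (A \<union> set ts) Fs))"
  using assms(1,2)
proof (induction xss arbitrary: F)
  case Nil
  then show ?case
    unfolding runs_def call_def[of branch_fn] wfh_program_nth branch_body_def
    by (simp add: exec_simps)
next
  case (Cons xs xss)
  then obtain F' where F': "distinct xs" "F = insert (set xs) F'" "set xs \<notin> F'"
      "lists_family xss F'"
    unfolding lists_family_Cons by blast
  define us where "us = list_union xs ts"
  define p where "p = (n + 1) * (k + 1)"
  have us: "distinct us" "set us = set xs \<union> set ts"
    using F' \<open>distinct ts\<close> by (simp_all add: us_def distinct_list_union)
  have len: "length xs = card (set xs)" "length us = card (set xs \<union> set ts)"
    using F' us by (metis distinct_card)+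
  have n: "length xs \<le> n" using Cons.prems F' len by simp
  have p: "n + k + 1 \<le> p" "(length xs + 1) * (length ts + 1) \<le> p"
    unfolding p_def using n \<open>length ts \<le> k\<close> by (simp, intro mult_mono, auto)
  have "length us \<le> n + k"
    using n \<open>length ts \<le> k\<close> length_list_union_le[of xs ts] unfolding us_def by linarith
  define q where "q = (\<exists>A\<in>F'. card A \<le> b \<and> card (A \<union> set ts) \<le> k \<and> reach k b (A \<union> set ts) Fs)"
  define C' where "C' = {A \<in> F'. card A \<le> b \<and> card (A \<union> set ts) \<le> k}"
  define s where "s = (\<Sum>A\<in>C'. nodes k b (A \<union> set ts) Fs)"
  have finC': "finite C'" "set xs \<notin> C'"
    using lists_family_finite[OF F'(4)] F'(3) by (auto simp: C'_def)
  have "runs branch_fn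
      [Atom (int k), Atom (int b), encode_set ts, encode_list encode_set xss, fv]
      (truth q) (10 + length xss * D + C * s)"
    unfolding q_def s_def C'_def using Cons.prems(2) F'(2) by (intro Cons.IH[OF F'(4)]) simp
  then obtain t where t: "t \<le> 10 + length xss * D + C * s"
    "\<forall>v' t'. call branch_fn
        [Atom (int k), Atom (int b), encode_set ts, encode_list encode_set xss, fv] v' t' \<longleftrightarrow>
      v' = truth q \<and> t' = t"
    by (rule runsE)
  obtain t1 where t1: "t1 \<le> 10 * (length xs + 1)"
    "\<forall>v' t'. call length_fn [encode_set xs] v' t' \<longleftrightarrow> v' = Atom (int (length xs)) \<and> t' = t1"
    using length_runs by (rule runsE)
  obtain t2 where t2: "t2 \<le> 40 * (length xs + 1) * (length ts + 1)"
    "\<forall>v' t'. call union_fn [encode_set xs, encode_set ts] v' t' \<longleftrightarrow> v' = encode_set us \<and> t' = t2"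
    using union_runs unfolding us_def by (rule runsE)
  obtain t3 where t3: "t3 \<le> 10 * (length us + 1)"
    "\<forall>v' t'. call length_fn [encode_set us] v' t' \<longleftrightarrow> v' = Atom (int (length us)) \<and> t' = t3"
    using length_runs by (rule runsE)
  \<comment> \<open>The constant 200 splits as 10 + 2 * 40 + 10 + 100: two lengths, two computations
    of the union, and the single steps.\<close>
  have bounds: "t1 + 2 * t2 + t3 + 100 \<le> D"
  proof -
    have "t2 \<le> 40 * p"
      using t2(1) mult_le_mono2[OF p(2), of 40] unfolding mult.assoc by (rule le_trans)
    moreover have "t1 \<le> 10 * p"
      by (rule le_trans[OF t1(1) mult_le_mono2]) (use p(1) n in simp)
    moreover have "t3 \<le> 10 * p"
      by (rule le_trans[OF t3(1) mult_le_mono2]) (use p(1) \<open>length us \<le> n + k\<close> in simp)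
    moreover have "1 \<le> p" using p(1) by simp
    moreover have "200 * p \<le> D" using D unfolding p_def .
    ultimately show ?thesis by linarith
  qed
  show ?case
  proof (cases "length xs \<le> b \<and> length us \<le> k")
    case False
    then have q: "(\<exists>A\<in>F. card A \<le> b \<and> card (A \<union> set ts) \<le> k \<and> reach k b (A \<union> set ts) Fs) = q"
      unfolding F'(2) q_def by (auto simp: len)
    have s: "{A \<in> F. card A \<le> b \<and> card (A \<union> set ts) \<le> k} = C'"
      using False unfolding F'(2) C'_def by (auto simp: len)
    define N where "N = 10 + length (xs # xss) * D + C * s"
    have N: "t + t1 + t2 + t3 + 100 \<le> N"
      using t(1) bounds by (simp add: N_def)
    show ?thesis
      unfolding q s s_def[symmetric] N_def[symmetric]
      unfolding runs_def call_def[of branch_fn] wfh_program_nth branch_body_def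
      using False N by (cases "length xs \<le> b") (simp_all add: t(2) t1(2) t2(2) t3(2) exec_simps)
  next
    case True
    then have q: "(\<exists>A\<in>F. card A \<le> b \<and> card (A \<union> set ts) \<le> k \<and> reach k b (A \<union> set ts) Fs)
        \<longleftrightarrow> reach k b (set us) Fs \<or> q"
      unfolding F'(2) q_def by (auto simp: len us)
    have "{A \<in> F. card A \<le> b \<and> card (A \<union> set ts) \<le> k} = insert (set xs) C'"
      using True unfolding F'(2) C'_def by (auto simp: len)
    then have s: "(\<Sum>A\<in>{A \<in> F. card A \<le> b \<and> card (A \<union> set ts) \<le> k}. nodes k b (A \<union> set ts) Fs)
        = nodes k b (set us) Fs + s"
      using finC' by (simp add: s_def us)
    have "runs search_fn [Atom (int k), Atom (int b), encode_set us, fv]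
        (truth (reach k b (set us) Fs)) (C * nodes k b (set us) Fs)"
      using assms(6) us(1) True unfolding search_correct_def by blast
    then obtain t4 where t4: "t4 \<le> C * nodes k b (set us) Fs"
      "\<forall>v' t'. call search_fn [Atom (int k), Atom (int b), encode_set us, fv] v' t' \<longleftrightarrow>
        v' = truth (reach k b (set us) Fs) \<and> t' = t4"
      by (rule runsE)
    define N where "N = 10 + length (xs # xss) * D + C * (nodes k b (set us) Fs + s)"
    have N: "t + t1 + 2 * t2 + t3 + t4 + 100 \<le> N"
      using t(1) t4(1) bounds by (simp add: N_def distrib_left)
    show ?thesis
      unfolding q s N_def[symmetric]
      unfolding runs_def call_def[of branch_fn] wfh_program_nth branch_body_def
      using True N
      by (cases "reach k b (set us) Fs")
        (simp_all add: t(2) t1(2) t2(2) t3(2) t4(2) exec_simps)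
  qed
qed

text \<open>The outer induction, along the families. A node scans at most \<open>n\<close> members
  at cost \<open>D\<close> each, and one more \<open>D\<close> covers its fixed overhead, hence
  \<open>D * (n + 1)\<close> per node.\<close>

lemma search_runs:
  assumes "list_all2 lists_family fs Fs"
    and "\<And>F. F \<in> set Fs \<Longrightarrow> card F \<le> n \<and> (\<forall>A\<in>F. card A \<le> n)"
    and D: "200 * ((n + 1) * (k + 1)) \<le> D"
  shows "search_correct k b (D * (n + 1)) Fs (encode_list (encode_list encode_set) fs)"
  using assms(1,2)
proof (induction fs Fs rule: list_all2_induct)
  case Nil
  show ?case
    using D unfolding search_correct_def runs_def call_def[of search_fn] wfh_program_nth
      search_body_def
    by (auto simp: exec_simps algebra_simps)
next
  case (Cons xss fs F Fs)
  let ?fv = "encode_list (encode_list encode_set) fs"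
  show ?case
    unfolding search_correct_def
  proof (intro allI impI)
    fix ts :: "nat list" assume ts: "distinct ts" "length ts \<le> k"
    have F: "card F \<le> n" "\<And>A. A \<in> F \<Longrightarrow> card A \<le> n" using Cons.prems[of F] by auto
    define s where
      "s = (\<Sum>A\<in>{A \<in> F. card A \<le> b \<and> card (A \<union> set ts) \<le> k}. nodes k b (A \<union> set ts) Fs)"
    have "search_correct k b (D * (n + 1)) Fs ?fv" using Cons.prems by (intro Cons.IH) auto
    then have "runs branch_fn
        [Atom (int k), Atom (int b), encode_set ts, encode_list encode_set xss, ?fv]
        (truth (reach k b (set ts) (F # Fs))) (10 + length xss * D + D * (n + 1) * s)"
      unfolding s_def reach.simps by (intro branch_runs[OF Cons.hyps(1) _ ts D] F(2))
    then obtain t where t: "t \<le> 10 + length xss * D + D * (n + 1) * s"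
      "\<forall>v' t'. call branch_fn
          [Atom (int k), Atom (int b), encode_set ts, encode_list encode_set xss, ?fv] v' t' \<longleftrightarrow>
        v' = truth (reach k b (set ts) (F # Fs)) \<and> t' = t"
      by (rule runsE)
    have "length xss * D \<le> n * D"
      using F lists_family_length[OF Cons.hyps(1)] by simp
    moreover have "200 \<le> D" using D by (simp add: algebra_simps)
    moreover define N where "N = D * (n + 1) * nodes k b (set ts) (F # Fs)"
    moreover have "nodes k b (set ts) (F # Fs) = 1 + s" by (simp add: s_def)
    then have "N = D + n * D + D * (n + 1) * s" by (simp add: N_def algebra_simps)
    ultimately have N: "t + 100 \<le> N" using t(1) by linarith
    show "runs search_fn [Atom (int k), Atom (int b), encode_set ts,
          encode_list (encode_list encode_set) (xss # fs)]
        (truth (reach k b (set ts) (F # Fs))) (D * (n + 1) * nodes k b (set ts) (F # Fs))"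
      unfolding N_def[symmetric]
      unfolding runs_def call_def[of search_fn] wfh_program_nth search_body_def
      using N by (simp add: t(2) exec_simps del: reach.simps)
  qed
qed

text \<open>Each start set \<open>B\<close> costs at most one search of at most \<open>E\<close>
  nodes; \<open>60 * (n + 1)\<close> covers two computations of its length and the single
  steps.\<close>

lemma start_family_runs:
  assumes "lists_family xss F" "\<And>A. A \<in> F \<Longrightarrow> card A \<le> n"
    and correct: "\<And>b. search_correct k b C Fs fv"
    and E: "\<And>A. A \<in> F \<Longrightarrow> card A \<le> k \<Longrightarrow> nodes k (card A) A Fs \<le> E"
  shows "runs start_family_fn [Atom (int k), encode_list encode_set xss, fv]
    (truth (\<exists>B\<in>F. card B \<le> k \<and> reach k (card B) B Fs))
    (10 + length xss * (C * E + 60 * (n + 1)))"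
  using assms(1,2,4)
proof (induction xss arbitrary: F)
  case Nil
  then show ?case
    unfolding runs_def call_def[of start_family_fn] wfh_program_nth start_family_body_def
    by (simp add: exec_simps)
next
  case (Cons xs xss)
  then obtain F' where F': "distinct xs" "F = insert (set xs) F'" "lists_family xss F'"
    unfolding lists_family_Cons by blast
  define q where "q = (\<exists>B\<in>F'. card B \<le> k \<and> reach k (card B) B Fs)"
  define D where "D = C * E + 60 * (n + 1)"
  define N where "N = 10 + length (xs # xss) * D"
  have len: "length xs = card (set xs)" using F' by (metis distinct_card)
  have n: "length xs \<le> n" using Cons.prems F' len by simp
  have "runs start_family_fn [Atom (int k), encode_list encode_set xss, fv]
      (truth q) (10 + length xss * D)"
    unfolding q_def D_def using Cons.prems(2,3) F'(2) by (intro Cons.IH[OF F'(3)]) simp_all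
  then obtain t where t: "t \<le> 10 + length xss * D"
    "\<forall>v' t'. call start_family_fn [Atom (int k), encode_list encode_set xss, fv] v' t' \<longleftrightarrow>
      v' = truth q \<and> t' = t"
    by (rule runsE)
  obtain t1 where t1: "t1 \<le> 10 * (length xs + 1)"
    "\<forall>v' t'. call length_fn [encode_set xs] v' t' \<longleftrightarrow> v' = Atom (int (length xs)) \<and> t' = t1"
    using length_runs by (rule runsE)
  show ?case
  proof (cases "length xs \<le> k")
    case False
    then have q: "(\<exists>B\<in>F. card B \<le> k \<and> reach k (card B) B Fs) = q"
      unfolding F'(2) q_def by (auto simp: len)
    have N: "t + t1 + 20 \<le> N"
      using t(1) t1(1) n by (simp add: N_def D_def)
    show ?thesis
      unfolding q D_def[symmetric] N_def[symmetric]
      unfolding runs_def call_def[of start_family_fn] wfh_program_nth start_family_body_def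
      using False N by (simp add: t(2) t1(2) exec_simps)
  next
    case True
    then have q: "(\<exists>B\<in>F. card B \<le> k \<and> reach k (card B) B Fs) \<longleftrightarrow>
        reach k (length xs) (set xs) Fs \<or> q"
      unfolding F'(2) q_def by (auto simp: len)
    have "runs search_fn [Atom (int k), Atom (int (length xs)), encode_set xs, fv]
        (truth (reach k (length xs) (set xs) Fs)) (C * nodes k (length xs) (set xs) Fs)"
      using correct[of "length xs"] F'(1) True unfolding search_correct_def by blast
    then obtain t4 where t4: "t4 \<le> C * nodes k (length xs) (set xs) Fs"
      "\<forall>v' t'. call search_fn [Atom (int k), Atom (int (length xs)), encode_set xs, fv] v' t' \<longleftrightarrow>
        v' = truth (reach k (length xs) (set xs) Fs) \<and> t' = t4"
      by (rule runsE)
    have "nodes k (length xs) (set xs) Fs \<le> E"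
      using Cons.prems(3)[of "set xs"] F'(2) True len by simp
    then have "t4 \<le> C * E" using t4(1) by (meson le_trans mult_le_mono2)
    then have N: "t + 2 * t1 + t4 + 30 \<le> N"
      using t(1) t1(1) n by (simp add: N_def D_def)
    show ?thesis
      unfolding q D_def[symmetric] N_def[symmetric]
      unfolding runs_def call_def[of start_family_fn] wfh_program_nth start_family_body_def
      using True N by (cases "reach k (length xs) (set xs) Fs")
        (simp_all add: t(2) t1(2) t4(2) exec_simps)
  qed
qed

text \<open>\<open>Gs\<close> is consumed by the induction while each search still runs through all
  of \<open>Fs\<close>, so the two are kept apart.\<close>

lemma start_runs:
  assumes "list_all2 lists_family gs Gs"
    and "\<And>G. G \<in> set Gs \<Longrightarrow> card G \<le> n \<and>
      (\<forall>A\<in>G. card A \<le> n \<and> (card A \<le> k \<longrightarrow> nodes k (card A) A Fs \<le> E))"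
    and correct: "\<And>b. search_correct k b C Fs fv"
  shows "runs start_fn [Atom (int k), encode_list (encode_list encode_set) gs, fv]
    (truth (\<exists>G\<in>set Gs. \<exists>B\<in>G. card B \<le> k \<and> reach k (card B) B Fs))
    (10 + length gs * (40 + n * (C * E + 60 * (n + 1))))"
  using assms(1,2)
proof (induction gs Gs rule: list_all2_induct)
  case Nil
  show ?case
    unfolding runs_def call_def[of start_fn] wfh_program_nth start_body_def
    by (simp add: exec_simps)
next
  case (Cons xss gs G Gs)
  define p where "p = (\<exists>B\<in>G. card B \<le> k \<and> reach k (card B) B Fs)"
  define q where "q = (\<exists>G\<in>set Gs. \<exists>B\<in>G. card B \<le> k \<and> reach k (card B) B Fs)"
  define D where "D = C * E + 60 * (n + 1)"
  define N where "N = 10 + length (xss # gs) * (40 + n * D)"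
  have G: "card G \<le> n" "\<And>A. A \<in> G \<Longrightarrow> card A \<le> n"
    "\<And>A. A \<in> G \<Longrightarrow> card A \<le> k \<Longrightarrow> nodes k (card A) A Fs \<le> E"
    using Cons.prems[of G] by auto
  have "runs start_family_fn [Atom (int k), encode_list encode_set xss, fv]
      (truth p) (10 + length xss * D)"
    unfolding p_def D_def by (intro start_family_runs[OF Cons.hyps(1) _ correct] G)
  then obtain t where t: "t \<le> 10 + length xss * D"
    "\<forall>v' t'. call start_family_fn [Atom (int k), encode_list encode_set xss, fv] v' t' \<longleftrightarrow>
      v' = truth p \<and> t' = t"
    by (rule runsE)
  have "runs start_fn [Atom (int k), encode_list (encode_list encode_set) gs, fv]
      (truth q) (10 + length gs * (40 + n * D))"
    unfolding q_def D_def by (intro Cons.IH Cons.prems) simp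
  then obtain u where u: "u \<le> 10 + length gs * (40 + n * D)"
    "\<forall>v' t'. call start_fn [Atom (int k), encode_list (encode_list encode_set) gs, fv] v' t' \<longleftrightarrow>
      v' = truth q \<and> t' = u"
    by (rule runsE)
  have "length xss * D \<le> n * D"
    using G lists_family_length[OF Cons.hyps(1)] by simp
  moreover have "N = 50 + n * D + length gs * (40 + n * D)" by (simp add: N_def)
  ultimately have N: "t + u + 20 \<le> N" using t(1) u(1) by linarith
  have q: "(\<exists>G\<in>set (G # Gs). \<exists>B\<in>G. card B \<le> k \<and> reach k (card B) B Fs) \<longleftrightarrow> p \<or> q"
    unfolding p_def q_def by simp
  show ?case
    unfolding q D_def[symmetric] N_def[symmetric]
    unfolding runs_def call_def[of start_fn] wfh_program_nth start_body_def
    using N by (cases p) (simp_all add: t(2) u(2) exec_simps)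
qed

section \<open>Input sizes and running times\<close>

definition size_bound :: "'a set set list \<Rightarrow> nat" where
  "size_bound Fs = max 1 (input_size Fs + num_degenerate Fs)"

lemma length_le_size_bound:
  assumes "\<And>F. F \<in> set Fs \<Longrightarrow> finite F \<and> (\<forall>A\<in>F. finite A)"
  shows "length Fs \<le> size_bound Fs"
proof -
  have "1 \<le> (\<Sum>A\<in>Fs ! i. card A) + (if Fs ! i \<subseteq> {{}} then 1 else 0)" if "i < length Fs" for i
  proof (cases "Fs ! i \<subseteq> {{}}")
    case False
    then obtain A where A: "A \<in> Fs ! i" "A \<noteq> {}" by auto
    have fin: "finite (Fs ! i)" "finite A" using assms[of "Fs ! i"] that A by auto
    then have "1 \<le> card A" using A by (simp add: Suc_le_eq card_gt_0_iff)
    also have "card A \<le> (\<Sum>A\<in>Fs ! i. card A)"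
      using A fin by (intro member_le_sum) auto
    finally show ?thesis by simp
  qed simp
  then have "(\<Sum>i<length Fs. 1)
      \<le> (\<Sum>i<length Fs. (\<Sum>A\<in>Fs ! i. card A) + (if Fs ! i \<subseteq> {{}} then 1 else 0))"
    by (intro sum_mono) simp
  also have "\<dots> = input_size Fs + num_degenerate Fs"
    unfolding sum.distrib input_size_def num_degenerate_def
    by (simp add: sum.If_cases Int_def)
  finally show ?thesis by (simp add: size_bound_def)
qed

text \<open>Only the empty set adds a member without adding to the input size. The factor 2 absorbs
  this one extra member, since \<open>size_bound\<close> is at least 1.\<close>

lemma family_le_size_bound:
  assumes "F \<in> set Fs" "finite F" "\<And>A. A \<in> F \<Longrightarrow> finite A"
  shows "card F \<le> 2 * size_bound Fs" and "A \<in> F \<Longrightarrow> card A \<le> 2 * size_bound Fs"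
proof -
  obtain i where i: "i < length Fs" "F = Fs ! i" using assms(1) by (auto simp: in_set_conv_nth)
  have "(\<Sum>A\<in>F. card A) \<le> input_size Fs"
    unfolding input_size_def i(2)
    by (rule member_le_sum[of i "{..<length Fs}" "\<lambda>i. \<Sum>A\<in>Fs ! i. card A"]) (use i in auto)
  then have le: "(\<Sum>A\<in>F. card A) \<le> size_bound Fs" by (simp add: size_bound_def)
  have "card F \<le> card (F - {{}}) + 1"
    using card_Diff_singleton_if[of F "{}"] assms(2) by (simp split: if_splits)
  also have "card (F - {{}}) = (\<Sum>A\<in>F - {{}}. 1)" by simp
  also have "\<dots> \<le> (\<Sum>A\<in>F - {{}}. card A)"
    using assms by (intro sum_mono) (simp add: Suc_le_eq card_gt_0_iff)
  also have "\<dots> \<le> (\<Sum>A\<in>F. card A)"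
    using assms by (intro sum_mono2) auto
  finally show "card F \<le> 2 * size_bound Fs"
    using le by (simp add: size_bound_def max_def split: if_splits)
  show "card A \<le> 2 * size_bound Fs" if "A \<in> F"
    using member_le_sum[of A F card] that assms(2) le by simp
qed

section \<open>Bounds in terms of k log k and the final estimate\<close>

lemma klogk_nonneg: "0 \<le> klogk k"
  by (simp add: klogk_def)

text \<open>For positive \<open>k\<close> take \<open>j = i + 1\<close> with \<open>i\<close> the
  rounded-down binary logarithm of \<open>k\<close>. The product is then at most 2 to the power 3k +
  2ki, where \<open>k * i\<close> is at most \<open>klogk\<close>. The factor \<open>k + 1\<close>
  comes from the cost of handling unions.\<close>

lemma power_le_klogk:
  "\<exists>j. k < 2 ^ j \<and> real ((k + 1) * (1 + k * 2 ^ k) ^ j) \<le> 8 * 2 powr (5 * klogk (int k))"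
proof (cases "k = 0")
  case True
  then show ?thesis by (intro exI[of _ 0]) (simp add: klogk_def)
next
  case False
  then obtain i where i: "2 ^ i \<le> k" "k < 2 ^ (i + 1)"
    using ex_power_ivl1[of 2 k] by auto
  have "real i \<le> log 2 (real k)"
    using i(1) by (intro le_log_of_power) (simp_all add: numeral_power_le_of_nat_cancel_iff)
  then have ki: "real k * real i \<le> klogk (int k)"
    using False by (simp add: klogk_def)
  have k1: "k + 1 \<le> 2 ^ k" by (metis Suc_eq_plus1 Suc_leI less_exp)
  have "1 + k * 2 ^ k \<le> (k + 1) * 2 ^ k" by simp
  also have "\<dots> \<le> 2 ^ k * 2 ^ k" using k1 by (intro mult_right_mono) auto
  also have "\<dots> = 2 ^ (2 * k)" by (simp add: mult_2 power_add)
  finally have "(k + 1) * (1 + k * 2 ^ k) ^ (i + 1) \<le> 2 ^ k * (2 ^ (2 * k)) ^ (i + 1)"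
    using k1 by (intro mult_mono power_mono) auto
  also have "\<dots> = 2 ^ (3 * k + 2 * k * i)"
    unfolding power_mult[symmetric] power_add[symmetric]
    by (rule arg_cong[where f = "power 2"]) (simp add: algebra_simps)
  finally have "real ((k + 1) * (1 + k * 2 ^ k) ^ (i + 1)) \<le> real (2 ^ (3 * k + 2 * k * i))"
    by (rule of_nat_mono)
  also have "\<dots> = 2 powr (3 * real k + 2 * (real k * real i))"
    by (simp add: powr_realpow[symmetric] mult.assoc)
  also have "\<dots> \<le> 2 powr (3 + 5 * klogk (int k))"
  proof (intro powr_mono)
    \<comment> \<open>The summand 1 is for \<open>k = 1\<close>, where \<open>klogk\<close>
      vanishes; it produces the factor 8 = 2 ^ 3.\<close>
    have "real k \<le> 1 + klogk (int k)"
    proof (cases "k = 1")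
      case False
      then have "1 \<le> i" using i \<open>k \<noteq> 0\<close> by (cases i) auto
      then have "real k * 1 \<le> real k * real i" by (intro mult_left_mono) auto
      then show ?thesis using ki by simp
    qed (simp add: klogk_nonneg)
    then show "3 * real k + 2 * (real k * real i) \<le> 3 + 5 * klogk (int k)"
      using ki by simp
  qed simp
  also have "\<dots> = 8 * 2 powr (5 * klogk (int k))" by (simp add: powr_add)
  finally show ?thesis using i by blast
qed

text \<open>The floor only turns the real bound into a natural number of steps.\<close>

lemma main_runs:
  assumes "wfh_instance k U Fs" "represents x k U Fs"
  shows "runs main_fn [x] (truth (wfh_solvable k Fs))
    (nat \<lfloor>1000000 * 2 powr (5 * klogk k) * real (size_bound Fs) ^ 5\<rfloor>)"
proof -
  obtain us fs where x: "x = encode_input k us fs" and fs: "list_all2 lists_family fs Fs"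
    using assms(2) unfolding represents_def by blast
  define N where "N = nat \<lfloor>1000000 * 2 powr (5 * klogk k) * real (size_bound Fs) ^ 5\<rfloor>"
  have Fs: "finite F \<and> (\<forall>A\<in>F. finite A) \<and> wide k F" if "F \<in> set Fs" for F
  proof -
    have "finite U" "F \<subseteq> Pow U" "wide k F" using assms(1) that by (auto simp: wfh_instance_def)
    then show ?thesis by (meson PowD finite_Pow_iff finite_subset subsetD)
  qed
  have "1 \<le> 2 powr (5 * klogk k)" by (rule ge_one_powr_ge_zero) (simp_all add: klogk_nonneg)
  moreover have "1 \<le> real (size_bound Fs) ^ 5" by (intro one_le_power) (simp add: size_bound_def)
  ultimately have "1 * 1 \<le> 2 powr (5 * klogk k) * real (size_bound Fs) ^ 5"
    by (intro mult_mono) auto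
  then have N_ge: "100 \<le> N" unfolding N_def by linarith
  have "runs main_fn [x] (truth (wfh_solvable k Fs)) N"
  proof (cases "k < 0 \<or> Fs = []")
    case True
    have "wfh_solvable k Fs \<longleftrightarrow> 0 \<le> k"
    proof (cases "k < 0")
      case False
      then show ?thesis using True by (simp add: wfh_solvable_def)
    qed (auto simp: wfh_solvable_def)
    moreover have "k < 0 \<or> fs = []" using True fs by auto
    ultimately show ?thesis
      unfolding x encode_input_def runs_def call_def[of main_fn] wfh_program_nth main_body_def
      using N_ge by (cases "k < 0") (simp_all add: exec_simps)
  next
    case False
    define K where "K = nat k"
    then have k: "k = int K" using False by simp
    define fv where "fv = encode_list (encode_list encode_set) fs"
    define n where "n = 2 * size_bound Fs"
    define D where "D = 200 * ((n + 1) * (K + 1))"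
    have sizes: "card F \<le> n \<and> (\<forall>A\<in>F. card A \<le> n)" if "F \<in> set Fs" for F
      using family_le_size_bound[of F Fs] Fs[OF that] that by (simp add: n_def)
    obtain j where j: "K < 2 ^ j"
      "real ((K + 1) * (1 + K * 2 ^ K) ^ j) \<le> 8 * 2 powr (5 * klogk k)"
      using power_le_klogk[of K] unfolding k by blast
    define g where "g = (1 + K * 2 ^ K) ^ j"
    define E where "E = (n + 1) * g"
    have lenFs: "length Fs \<le> n"
      using length_le_size_bound[of Fs] Fs by (fastforce simp: n_def)
    have E: "nodes K (card B) B Fs \<le> E" if "F \<in> set Fs" "B \<in> F" "card B \<le> K" for F B
    proof -
      have "growth (2 ^ card B) (K - card B) \<le> (1 + K * 2 ^ card B) ^ j"
        using j(1) by (intro growth_le_power) auto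
      also have "\<dots> \<le> g"
        unfolding g_def using that(3)
        by (intro power_mono add_left_mono mult_left_mono power_increasing) auto
      finally have g: "growth (2 ^ card B) (K - card B) \<le> g" .
      have "nodes K (card B) B Fs \<le> (length Fs + 1) * growth (2 ^ card B) (K - card B)"
        using that Fs unfolding k by (intro nodes_le) auto
      also have "\<dots> \<le> E"
        unfolding E_def using lenFs g by (intro mult_le_mono) auto
      finally show ?thesis .
    qed
    have "runs start_fn [Atom (int K), fv, fv]
        (truth (\<exists>F\<in>set Fs. \<exists>B\<in>F. card B \<le> K \<and> reach K (card B) B Fs))
        (10 + length fs * (40 + n * (D * (n + 1) * E + 60 * (n + 1))))"
      unfolding fv_def using sizes E
      by (intro start_runs[OF fs] search_runs[OF fs]) (auto simp: D_def)
    moreover have "(\<exists>F\<in>set Fs. \<exists>B\<in>F. card B \<le> K \<and> reach K (card B) B Fs) \<longleftrightarrow> wfh_solvable k Fs"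
      using wfh_solvable_iff_reach[of Fs K] Fs False unfolding k by blast
    ultimately obtain t where
      t: "t \<le> 10 + length fs * (40 + n * (D * (n + 1) * E + 60 * (n + 1)))"
      "\<forall>v' t'. call start_fn [Atom (int K), fv, fv] v' t' \<longleftrightarrow>
        v' = truth (wfh_solvable k Fs) \<and> t' = t"
      by (auto elim: runsE)
    define y where "y = n + 1"
    define h where "h = (K + 1) * g"
    have pos: "1 \<le> y" "1 \<le> h" by (simp_all add: y_def h_def g_def Suc_le_eq)
    have "length fs * (40 + n * (D * (n + 1) * E + 60 * (n + 1)))
        \<le> y * (40 + y * (D * (n + 1) * E + 60 * (n + 1)))"
      using lenFs list_all2_lengthD[OF fs] unfolding y_def
      by (intro mult_le_mono add_left_mono) auto
    \<comment> \<open>The five factors \<open>y\<close> of the leading term bound the number of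
      families, the start sets per family, the set sizes in \<open>D\<close>, the members scanned
      per node, and the levels of the tree.\<close>
    then have "t + 50 \<le> 60 + y * (40 + y * (200 * (y * (K + 1)) * y * (y * g) + 60 * y))"
      using t(1) unfolding D_def E_def y_def[symmetric] by linarith
    also have "\<dots> = 60 + 40 * y + 60 * y ^ 3 + 200 * (y ^ 5 * h)"
      by (simp add: h_def power_numeral_reduce algebra_simps)
    also have "\<dots> \<le> 400 * (y ^ 5 * h)"
    proof -
      have le: "y ^ i * 1 \<le> y ^ 5 * h" if "i \<le> 5" for i
        using pos that by (intro mult_mono power_increasing) auto
      have "1 \<le> y ^ 5 * h" "y \<le> y ^ 5 * h" "y ^ 3 \<le> y ^ 5 * h"
        using le[of 0] le[of 1] le[of 3] by (simp_all only: power_0 power_one_right mult_1_right)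
      then show ?thesis by linarith
    qed
    finally have "real (t + 50) \<le> 400 * (real y ^ 5 * real h)"
      by (metis of_nat_le_iff of_nat_mult of_nat_numeral of_nat_power)
    \<comment> \<open>As \<open>size_bound Fs\<close> is at least 1, y = 2 *
      \<open>size_bound Fs\<close> + 1 is at most three times it; then 400 * 3 ^ 5 * 8 = 777600
      stays below 1000000.\<close>
    also have "\<dots> \<le> 400 * ((3 * real (size_bound Fs)) ^ 5 * (8 * 2 powr (5 * klogk k)))"
      using j(2) unfolding h_def g_def y_def n_def
      by (intro mult_left_mono mult_mono power_mono) (auto simp: size_bound_def)
    also have "\<dots> \<le> 1000000 * 2 powr (5 * klogk k) * real (size_bound Fs) ^ 5"
      by (simp add: power_mult_distrib)
    finally have N: "t + 50 \<le> N" unfolding N_def by linarith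
    \<comment> \<open>A nonempty list of families is encoded by a cell, so the test in
      \<open>main_body\<close> leads to the start function.\<close>
    obtain f fs' where "fs = f # fs'" using False fs by (cases fs) auto
    then obtain a b where "fv = Cell a b" by (simp add: fv_def)
    then show ?thesis
      unfolding x encode_input_def fv_def[symmetric] runs_def call_def[of main_fn]
        wfh_program_nth main_body_def
      using N t(2) by (simp add: exec_simps k)
  qed
  then show ?thesis by (simp add: N_def)
qed

theorem theorem7:
  shows "\<exists>P :: program. solves_wfh P \<and>
    (\<exists>c :: nat. runs_in_time P (\<lambda>k Fs.
       real c * 2 powr (real c * klogk k)
         * real (max 1 (input_size Fs + num_degenerate Fs)) ^ c))"
proof -
  \<comment> \<open>One constant serves as factor, coefficient in the exponent and degree. Enlarging
    the latter two from 5 is harmless because \<open>klogk\<close> is nonnegative and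
    \<open>size_bound\<close> is at least 1.\<close>
  define c :: nat where "c = 1000000"
  have c: "1000000 \<le> c" by (simp add: c_def)
  have computes: "computes wfh_program x v t \<longleftrightarrow> call main_fn [x] v t" for x v t
    by (simp add: computes_def call_def main_fn_def wfh_program_def)
  have "solves_wfh wfh_program"
    unfolding solves_wfh_def computes using main_runs unfolding runs_def by blast
  moreover have "runs_in_time wfh_program (\<lambda>k Fs. real c * 2 powr (real c * klogk k)
      * real (max 1 (input_size Fs + num_degenerate Fs)) ^ c)"
    unfolding runs_in_time_def computes size_bound_def[symmetric]
  proof (intro allI impI)
    fix k U Fs x assume "wfh_instance k U Fs" "represents x k U Fs"
    then obtain t where t: "call main_fn [x] (truth (wfh_solvable k Fs)) t"
      "t \<le> nat \<lfloor>1000000 * 2 powr (5 * klogk k) * real (size_bound Fs) ^ 5\<rfloor>"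
      using main_runs unfolding runs_def by blast
    have "real t \<le> real (nat \<lfloor>1000000 * 2 powr (5 * klogk k) * real (size_bound Fs) ^ 5\<rfloor>)"
      using t(2) by (rule of_nat_mono)
    also have "\<dots> \<le> 1000000 * 2 powr (5 * klogk k) * real (size_bound Fs) ^ 5"
      by (rule of_nat_floor) simp
    also have "\<dots> \<le> real c * 2 powr (real c * klogk k) * real (size_bound Fs) ^ c"
    proof (intro mult_mono)
      show "2 powr (5 * klogk k) \<le> 2 powr (real c * klogk k)"
        using klogk_nonneg[of k] c by (intro powr_mono mult_right_mono) auto
      show "real (size_bound Fs) ^ 5 \<le> real (size_bound Fs) ^ c"
        using c by (intro power_increasing) (simp_all add: size_bound_def)
    qed (use c in simp_all)
    finally show "\<exists>v t. call main_fn [x] v t \<and> real t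
        \<le> real c * 2 powr (real c * klogk k) * real (size_bound Fs) ^ c"
      using t(1) by blast
  qed
  ultimately show ?thesis by blast
qed

end
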